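(* Let $\Lambda\subset\mathbb{N}_0^d$ be an arbitrary finite index set. A rank-1 lattice rule $Q_n^*$ with $n$ points and generating vector $\boldsymbol{z}\in\mathbb{Z}^d$ reconstructs exactly the Chebyshev coefficients of all Chebyshev space functions $f\in\mathcal{F}^{\rm Cheb}_\Lambda$ solely supported on $\Lambda$, by $$\widehat f_{\boldsymbol{k}}=\widehat f^{\,a}_{\boldsymbol{k}}:=Q_n^*\big(f(\cos(2\pi\,\bullet\,))\,(\phi_{\boldsymbol{k}}\circ\varphi_{\rm tent})\big)\qquad\text{for all }\boldsymbol{k}\in\Lambda,$$ if and only if $$\boldsymbol{h}\cdot\boldsymbol{z}\not\equiv0\pmod n\qquad\text{for all }\boldsymbol{h}\in(\mathcal{M}(\Lambda)\oplus\mathcal{M}(\Lambda))\setminus\{\boldsymbol{0}\}.$$ Such a generating vector $\boldsymbol{z}$ can be constructed component-by-component if $n$ is a prime satisfying $$n>\max\Big\{\frac{\#(\mathcal{M}(\Lambda)\oplus\mathcal{M}(\Lambda))+1}{2},\ 2\max(\Lambda)\Big\}.$$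
   Context: Chebyshev basis on $[-1,1]^d$: $\eta_{\boldsymbol{k}}(\boldsymbol{x})=\sqrt2^{\,|\boldsymbol{k}|_0}\prod_{j=1}^dT_{k_j}(x_j)$, $\boldsymbol{k}\in\mathbb{N}_0^d$, $T_k(x)=\cos(k\arccos x)$, $|\boldsymbol{k}|_0$ the number of nonzero components. $\mathcal{F}^{\rm Cheb}_\Lambda$ is the set of real-valued functions $f=\sum_{\boldsymbol{k}\in\Lambda}\widehat f_{\boldsymbol{k}}\,\eta_{\boldsymbol{k}}$ on $[-1,1]^d$; the Chebyshev coefficients are $\widehat f_{\boldsymbol{k}}=\int_{[-1,1]^d}f\,\eta_{\boldsymbol{k}}\,\mu(d\boldsymbol{x})$ with $\mu(d\boldsymbol{x})=d\boldsymbol{x}/\prod_{j=1}^d(\pi\sqrt{1-x_j^2})$. Also $\phi_{\boldsymbol{k}}(\boldsymbol{x})=\sqrt2^{\,|\boldsymbol{k}|_0}\prod_{j=1}^d\cos(\pi k_jx_j)$ on $[0,1]^d$, and $\varphi_{\rm tent}(x)=1-|2x-1|$ is applied componentwise. The rank-1 lattice rule is $Q_n^*(g)=\frac1n\sum_{i=0}^{n-1}g\big(\frac{i\boldsymbol{z}\bmod n}{n}\big)$ (mod applied componentwise); $f(\cos(2\pi\,\bullet))$ denotes $\boldsymbol{x}\mapsto f(\cos(2\pi x_1),\ldots,\cos(2\pi x_d))$. $\mathcal{M}(\Lambda)=\{(\sigma_1k_1,\ldots,\sigma_dk_d):\boldsymbol{k}\in\Lambda,\boldsymbol{\sigma}\in\{\pm1\}^d\}$;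 $A\oplus B=\{\boldsymbol{a}+\boldsymbol{b}:\boldsymbol{a}\in A,\boldsymbol{b}\in B\}$; $\max(\Lambda)=\max_{\boldsymbol{k}\in\Lambda}\max_j|k_j|$; $\#$ is cardinality. "Constructed component-by-component": for an index set $\mathcal{A}\subset\mathbb{Z}^d$ (here $\mathcal{A}=\mathcal{M}(\Lambda)\oplus\mathcal{M}(\Lambda)$) and its projections $\mathcal{A}_s$, $s=1,\ldots,d$, given either by $\mathcal{A}_s=\{\boldsymbol{h}\in\mathbb{Z}^s:(\boldsymbol{h},\boldsymbol{0})\in\mathcal{A}\}$ or by $\mathcal{A}_s=\{\boldsymbol{h}\in\mathbb{Z}^s:(\boldsymbol{h},\boldsymbol{h}_\perp)\in\mathcal{A}\text{ for some }\boldsymbol{h}_\perp\}$, the components $z_1,\ldots,z_d\in\{1,\ldots,n-1\}$ can be chosen one at a time: whenever $z_1,\ldots,z_{s-1}$ satisfy $\boldsymbol{h}\cdot(z_1,\ldots,z_{s-1})\not\equiv0\pmod n$ for all $\boldsymbol{h}\in\mathcal{A}_{s-1}\setminus\{\boldsymbol{0}\}$ (no condition if $s=1$), there exists $z_s\in\{1,\ldots,n-1\}$ with $\boldsymbol{h}\cdot(z_1,\ldots,z_s)\not\equiv0\pmod n$ for all $\boldsymbol{h}\in\mathcal{A}_s\setminus\{\boldsymbol{0}\}$. Since $\mathcal{A}_d=\mathcal{A}$, the resulting $\boldsymbol{z}$ satisfies the required condition. *)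

theory Defs
  imports "HOL-Analysis.Analysis" "HOL-Number_Theory.Number_Theory"
begin

text \<open>
  Integer vectors (frequencies, multi-indices, generating vectors) of dimension \<open>s\<close> are lists of
  length \<open>s\<close>; the component \<open>h\<^sub>j\<close>, \<open>1 \<le> j \<le> s\<close>, is \<open>h ! (j - 1)\<close>.  Real points of dimension \<open>d\<close> are
  extensional functions on \<open>{..<d}\<close>, as required by the product measure \<open>Pi\<^sub>M\<close>.
\<close>

definition num_nonzero :: "nat list \<Rightarrow> nat" where
  "num_nonzero k = card {j. j < length k \<and> k ! j \<noteq> 0}"

definition cheb_T :: "nat \<Rightarrow> real \<Rightarrow> real" where
  "cheb_T k x = cos (real k * arccos x)"

definition cheb_basis :: "nat list \<Rightarrow> (nat \<Rightarrow> real) \<Rightarrow> real" where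
  "cheb_basis k x = sqrt 2 ^ num_nonzero k * (\<Prod>j<length k. cheb_T (k ! j) (x j))"

definition cos_basis :: "nat list \<Rightarrow> (nat \<Rightarrow> real) \<Rightarrow> real" where
  "cos_basis k x = sqrt 2 ^ num_nonzero k * (\<Prod>j<length k. cos (pi * real (k ! j) * x j))"

definition tent :: "real \<Rightarrow> real" where
  "tent x = 1 - \<bar>2 * x - 1\<bar>"

text \<open>
  The space of the following measure is \<open>[-1,1]\<^sup>d\<close>.  On the null set where some \<open>x j\<close> is \<open>1\<close> or
  \<open>-1\<close>, the density takes the value \<open>1 / 0 = 0\<close>.
\<close>

definition cheb_measure :: "nat \<Rightarrow> (nat \<Rightarrow> real) measure" where
  "cheb_measure d =
     density (Pi\<^sub>M {..<d} (\<lambda>_. restrict_space lborel {-1..1}))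
       (\<lambda>x. ennreal (1 / (\<Prod>j<d. pi * sqrt (1 - (x j)\<^sup>2))))"

definition cheb_coeff :: "nat \<Rightarrow> ((nat \<Rightarrow> real) \<Rightarrow> real) \<Rightarrow> nat list \<Rightarrow> real" where
  "cheb_coeff d f k = (\<integral>x. f x * cheb_basis k x \<partial>cheb_measure d)"

text \<open>
  Only the values on \<open>[-1,1]\<^sup>d\<close> are constrained: a function on the cube is represented by any of
  its extensions.
\<close>

definition cheb_space :: "nat \<Rightarrow> nat list set \<Rightarrow> ((nat \<Rightarrow> real) \<Rightarrow> real) set" where
  "cheb_space d \<Lambda> =
     {f. \<exists>c. \<forall>x \<in> {..<d} \<rightarrow>\<^sub>E {-1..1}. f x = (\<Sum>k\<in>\<Lambda>. c k * cheb_basis k x)}"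

definition lattice_rule :: "nat \<Rightarrow> int list \<Rightarrow> ((nat \<Rightarrow> real) \<Rightarrow> real) \<Rightarrow> real" where
  "lattice_rule n z g =
     (1 / real n) * (\<Sum>i<n. g (\<lambda>j\<in>{..<length z}. real_of_int ((int i * z ! j) mod int n) / real n))"

definition approx_coeff ::
    "nat \<Rightarrow> nat \<Rightarrow> int list \<Rightarrow> ((nat \<Rightarrow> real) \<Rightarrow> real) \<Rightarrow> nat list \<Rightarrow> real" where
  "approx_coeff d n z f k =
     lattice_rule n z
       (\<lambda>x. f (\<lambda>j\<in>{..<d}. cos (2 * pi * x j)) * cos_basis k (\<lambda>j\<in>{..<d}. tent (x j)))"

definition mirror :: "nat list set \<Rightarrow> int list set" where
  "mirror \<Lambda> =
     {map2 (\<lambda>s m. s * int m) \<sigma> k | \<sigma> k. k \<in> \<Lambda> \<and> length \<sigma> = length k \<and> set \<sigma> \<subseteq> {1, -1}}"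

definition set_sum :: "int list set \<Rightarrow> int list set \<Rightarrow> int list set" where
  "set_sum A B = {map2 (+) a b | a b. a \<in> A \<and> b \<in> B}"

text \<open>Inserting \<open>0\<close> only matters for \<open>\<Lambda> = {}\<close>, where the maximum is taken to be \<open>0\<close>.\<close>

definition max_index :: "nat list set \<Rightarrow> nat" where
  "max_index \<Lambda> = Max (insert 0 (\<Union>k\<in>\<Lambda>. set k))"

definition dot :: "int list \<Rightarrow> int list \<Rightarrow> int" where
  "dot h z = (\<Sum>j<length z. h ! j * z ! j)"

definition nonvanishing :: "nat \<Rightarrow> int list set \<Rightarrow> int list \<Rightarrow> bool" where
  "nonvanishing n A z \<longleftrightarrow>
     (\<forall>h \<in> A - {replicate (length z) 0}. \<not> [dot h z = 0] (mod int n))"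

definition zero_projection :: "nat \<Rightarrow> int list set \<Rightarrow> nat \<Rightarrow> int list set" where
  "zero_projection d A s = {h. length h = s \<and> h @ replicate (d - s) 0 \<in> A}"

definition full_projection :: "nat \<Rightarrow> int list set \<Rightarrow> nat \<Rightarrow> int list set" where
  "full_projection d A s = {h. length h = s \<and> (\<exists>h'. length h' = d - s \<and> h @ h' \<in> A)}"

text \<open>
  Here \<open>P s\<close> is the projection of the index set to the first \<open>s\<close> components.  For \<open>s = 1\<close> the
  premise on \<open>zs = []\<close> is vacuous, since \<open>P 0 \<subseteq> {[]}\<close> for both projections above.
\<close>

definition cbc_constructible :: "nat \<Rightarrow> nat \<Rightarrow> (nat \<Rightarrow> int list set) \<Rightarrow> bool" where
  "cbc_constructible d n P \<longleftrightarrow>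
     (\<forall>s \<in> {1..d}. \<forall>zs. length zs = s - 1 \<and> set zs \<subseteq> {1..int n - 1} \<and> nonvanishing n (P (s - 1)) zs
        \<longrightarrow> (\<exists>z \<in> {1..int n - 1}. nonvanishing n (P s) (zs @ [z])))"

end

theory Submission
  imports Defs
begin

text \<open>
  Both the integral and the lattice rule only see sums of frequencies. Under \<open>x = cos \<theta>\<close> the
  functions \<open>\<eta>\<^sub>k\<close> become products of cosines, and in each coordinate
  \<open>cos (k \<theta>) cos (l \<theta>)\<close> is the average of \<open>exp (\<i> (s k + t l) \<theta>)\<close> over the four sign pairs
  \<open>(s, t)\<close>. Choosing a sign pair for every coordinate turns \<open>\<eta>\<^sub>k \<eta>\<^sub>l\<close> into a positive
  multiple of an average of \<open>4\<^sup>d\<close> characters whose frequencies are exactly the elements \<open>h = \<sigma>(k) + \<tau>(l)\<close> of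
  \<open>\<M>(\<Lambda>) \<oplus> \<M>(\<Lambda>)\<close> that \<open>k\<close> and \<open>l\<close> contribute. The Chebyshev integral retains the characters with
  \<open>h = 0\<close> (\<open>has_bochner_integral_cheb_basis_mult\<close>), the lattice rule those with
  \<open>h \<cdot> z \<equiv> 0 (mod n)\<close> (\<open>approx_coeff_cheb_basis\<close>), and both with the same positive weight. So the
  aliasing error for the pair \<open>k, l\<close> is a positive multiple of the number of sign choices with
  \<open>h \<noteq> 0\<close> and \<open>h \<cdot> z \<equiv> 0\<close>. Since errors cannot cancel within a pair, reconstruction of the
  basis functions, hence by linearity of the whole space, holds iff no such \<open>h\<close> exists
  (\<open>reconstruction_iff_nonvanishing\<close>).

  For the construction of \<open>z\<close>, let \<open>z\<^sub>1, \<dots>, z\<^sub>s\<^sub>-\<^sub>1\<close> be admissible. A vector \<open>h\<close> with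
  \<open>h\<^sub>s = 0\<close> imposes nothing new. If \<open>h\<^sub>s \<noteq> 0\<close>, then \<open>\<bar>h\<^sub>s\<bar> \<le> 2 max \<Lambda> < n\<close> makes \<open>h\<^sub>s\<close> invertible
  modulo the prime \<open>n\<close>, so \<open>h\<close> excludes at most one residue for \<open>z\<^sub>s\<close>; and \<open>-h\<close>, which also lies in
  the index set, excludes the same one. So at most \<open>(#\<A> - 1) / 2 < n - 1\<close> residues are excluded,
  where \<open>\<A> = \<M>(\<Lambda>) \<oplus> \<M>(\<Lambda>)\<close>, and one of \<open>1, \<dots>, n - 1\<close> remains (\<open>nonvanishing_extension\<close>).
\<close>

section \<open>Signed sums of frequencies\<close>

definition sign_pairs :: "(int \<times> int) set" where
  "sign_pairs = {1, -1} \<times> {1, -1}"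

definition signed_sum :: "nat \<Rightarrow> nat \<Rightarrow> int \<times> int \<Rightarrow> int" where
  "signed_sum k l p = fst p * int k + snd p * int l"

text \<open>
  Extensional, so that a product over the coordinates of sums over \<open>sign_pairs\<close> expands into one
  sum over this set.
\<close>

definition sign_choices :: "nat \<Rightarrow> (nat \<Rightarrow> int \<times> int) set" where
  "sign_choices d = {..<d} \<rightarrow>\<^sub>E sign_pairs"

definition signed_sums :: "nat list \<Rightarrow> nat list \<Rightarrow> (nat \<Rightarrow> int \<times> int) \<Rightarrow> int list" where
  "signed_sums k l \<rho> = map (\<lambda>j. signed_sum (k ! j) (l ! j) (\<rho> j)) [0..<length k]"

lemma finite_sign_pairs [simp]: "finite sign_pairs"
  by (simp add: sign_pairs_def)

lemma finite_sign_choices [simp]: "finite (sign_choices d)"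
  by (simp add: sign_choices_def finite_PiE)

lemma sum_sign_pairs: "(\<Sum>p\<in>sign_pairs. f p) = f (1, 1) + f (1, -1) + f (-1, 1) + f (-1, -1)"
  for f :: "int \<times> int \<Rightarrow> 'a::comm_monoid_add"
  by (simp add: sign_pairs_def sum.cartesian_product[symmetric] add.assoc)

lemma prod_sum_sign_choices:
  "(\<Prod>j<d. (\<Sum>p\<in>sign_pairs. f j p) / 4) = (\<Sum>\<rho>\<in>sign_choices d. \<Prod>j<d. f j (\<rho> j)) / 4 ^ d"
  for f :: "nat \<Rightarrow> int \<times> int \<Rightarrow> 'a::field"
  unfolding prod_dividef sign_choices_def by (subst prod_sum_PiE) auto

lemma signed_sums_eq_zero_iff:
  "signed_sums k l \<rho> = replicate (length k) 0
     \<longleftrightarrow> (\<forall>j<length k. signed_sum (k ! j) (l ! j) (\<rho> j) = 0)"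
  by (subst list_eq_iff_nth_eq) (simp add: signed_sums_def)

text \<open>
  Links the index set to the expansions below: one sign choice packs the sign patterns of both
  summands, so the frequencies produced by multiplying out two basis functions are the elements
  of the index set.
\<close>

lemma set_sum_mirror:
  assumes len: "\<forall>k\<in>\<Lambda>. length k = d"
  shows "set_sum (mirror \<Lambda>) (mirror \<Lambda>)
    = {signed_sums k l \<rho> | k l \<rho>. k \<in> \<Lambda> \<and> l \<in> \<Lambda> \<and> \<rho> \<in> sign_choices d}" (is "?L = ?R")
proof (intro equalityI subsetI)
  fix h assume "h \<in> ?L"
  then obtain \<sigma> k \<tau> l where h: "h = map2 (+) (map2 (\<lambda>s m. s * int m) \<sigma> k) (map2 (\<lambda>s m. s * int m) \<tau> l)"
    and kl: "k \<in> \<Lambda>" "l \<in> \<Lambda>" and \<sigma>: "length \<sigma> = d" "set \<sigma> \<subseteq> {1, -1}" and \<tau>: "length \<tau> = d" "set \<tau> \<subseteq> {1, -1}"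
    using len unfolding set_sum_def mirror_def by auto
  have "length k = d" "length l = d" using kl len by auto
  define \<rho> where "\<rho> = (\<lambda>j\<in>{..<d}. (\<sigma> ! j, \<tau> ! j))"
  have "\<sigma> ! j \<in> {1, -1}" "\<tau> ! j \<in> {1, -1}" if "j < d" for j
    using that \<sigma> \<tau> subsetD[OF \<sigma>(2) nth_mem[of j \<sigma>]] subsetD[OF \<tau>(2) nth_mem[of j \<tau>]] by simp_all
  then have "\<rho> \<in> sign_choices d"
    unfolding \<rho>_def sign_choices_def sign_pairs_def restrict_PiE_iff
    by (intro ballI SigmaI) simp_all
  moreover have "h = signed_sums k l \<rho>"
    by (rule nth_equalityI)
       (simp_all add: h signed_sums_def signed_sum_def \<rho>_def \<open>length k = d\<close> \<open>length l = d\<close> \<sigma> \<tau>)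
  ultimately show "h \<in> ?R" using kl by blast
next
  fix h assume "h \<in> ?R"
  then obtain k l \<rho> where h: "h = signed_sums k l \<rho>" "k \<in> \<Lambda>" "l \<in> \<Lambda>" "\<rho> \<in> sign_choices d"
    by blast
  define \<sigma> \<tau> where "\<sigma> = map (\<lambda>j. fst (\<rho> j)) [0..<d]" and "\<tau> = map (\<lambda>j. snd (\<rho> j)) [0..<d]"
  have kl: "length k = d" "length l = d" using h len by auto
  have "fst (\<rho> j) \<in> {1, -1} \<and> snd (\<rho> j) \<in> {1, -1}" if "j < d" for j
    using PiE_mem[OF h(4)[unfolded sign_choices_def], of j] that by (auto simp: sign_pairs_def)
  then have "set \<sigma> \<subseteq> {1, -1}" "set \<tau> \<subseteq> {1, -1}"
    by (simp_all add: \<sigma>_def \<tau>_def image_subset_iff)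
  moreover have "length \<sigma> = length k" "length \<tau> = length l"
    using kl by (simp_all add: \<sigma>_def \<tau>_def)
  ultimately have "map2 (\<lambda>s m. s * int m) \<sigma> k \<in> mirror \<Lambda>" "map2 (\<lambda>s m. s * int m) \<tau> l \<in> mirror \<Lambda>"
    unfolding mirror_def using h by blast+
  moreover have "h = map2 (+) (map2 (\<lambda>s m. s * int m) \<sigma> k) (map2 (\<lambda>s m. s * int m) \<tau> l)"
    by (rule nth_equalityI) (simp_all add: h signed_sums_def signed_sum_def \<sigma>_def \<tau>_def kl)
  ultimately show "h \<in> ?L"
    unfolding set_sum_def by blast
qed

text \<open>
  The features of the index set that the construction of \<open>z\<close> exploits. Negation flips all signs;
  the zero vector is \<open>k - k\<close>.
\<close>

lemma set_sum_mirror_properties: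
  fixes \<Lambda> :: "nat list set"
  assumes fin: "finite \<Lambda>" and len: "\<forall>k\<in>\<Lambda>. length k = d"
  defines "A \<equiv> set_sum (mirror \<Lambda>) (mirror \<Lambda>)"
  shows "finite A"
    and "h \<in> A \<Longrightarrow> length h = d"
    and "h \<in> A \<Longrightarrow> map uminus h \<in> A"
    and "A \<noteq> {} \<Longrightarrow> replicate d 0 \<in> A"
    and "h \<in> A \<Longrightarrow> x \<in> set h \<Longrightarrow> \<bar>x\<bar> \<le> 2 * int (max_index \<Lambda>)"
proof -
  note A = set_sum_mirror[OF len, folded A_def]
  have "A = (\<lambda>(k, l, \<rho>). signed_sums k l \<rho>) ` (\<Lambda> \<times> \<Lambda> \<times> sign_choices d)"
    unfolding A by force
  then show "finite A"
    using fin by simp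
  show "length h = d" if "h \<in> A"
    using that len unfolding A by (auto simp: signed_sums_def)
  show "map uminus h \<in> A" if "h \<in> A"
  proof -
    from that obtain k l \<rho> where h: "h = signed_sums k l \<rho>" "k \<in> \<Lambda>" "l \<in> \<Lambda>" "\<rho> \<in> sign_choices d"
      unfolding A by blast
    define \<rho>' where "\<rho>' = (\<lambda>j\<in>{..<d}. (- fst (\<rho> j), - snd (\<rho> j)))"
    have "\<rho> j \<in> sign_pairs" if "j < d" for j
      using PiE_mem[OF h(4)[unfolded sign_choices_def]] that by simp
    then have "\<rho>' \<in> sign_choices d"
      unfolding \<rho>'_def sign_choices_def restrict_PiE_iff by (force simp: sign_pairs_def)
    moreover have "map uminus h = signed_sums k l \<rho>'"
      using h len by (simp add: signed_sums_def signed_sum_def \<rho>'_def)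
    ultimately show ?thesis
      using h unfolding A by blast
  qed
  show "replicate d 0 \<in> A" if "A \<noteq> {}"
  proof -
    from that obtain k where k: "k \<in> \<Lambda>"
      unfolding A by blast
    have "(\<lambda>j\<in>{..<d}. (1, -1)) \<in> sign_choices d"
      unfolding sign_choices_def restrict_PiE_iff by (simp add: sign_pairs_def)
    moreover have "signed_sums k k (\<lambda>j\<in>{..<d}. (1, -1)) = replicate d 0"
      using k len signed_sums_eq_zero_iff[of k k "\<lambda>j\<in>{..<d}. (1, -1)"] by (simp add: signed_sum_def)
    ultimately show ?thesis
      using k unfolding A by force
  qed
  show "\<bar>x\<bar> \<le> 2 * int (max_index \<Lambda>)" if "h \<in> A" "x \<in> set h"
  proof -
    from that obtain k l \<rho> where h: "h = signed_sums k l \<rho>" and kl: "k \<in> \<Lambda>" "l \<in> \<Lambda>" and \<rho>: "\<rho> \<in> sign_choices d"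
      unfolding A by blast
    then obtain j where j: "j < d" "x = signed_sum (k ! j) (l ! j) (\<rho> j)"
      using \<open>x \<in> set h\<close> len by (auto simp: signed_sums_def)
    have "m ! j \<le> max_index \<Lambda>" if "m \<in> \<Lambda>" for m
    proof -
      have "m ! j \<in> set m"
        using that len j(1) by simp
      then have "m ! j \<in> insert 0 (\<Union>k\<in>\<Lambda>. set k)"
        using that by blast
      then show ?thesis
        unfolding max_index_def using fin by (intro Max_ge) auto
    qed
    then have "k ! j \<le> max_index \<Lambda>" "l ! j \<le> max_index \<Lambda>"
      using kl by auto
    moreover have "\<rho> j \<in> sign_pairs"
      using PiE_mem[OF \<rho>[unfolded sign_choices_def]] j by simp
    ultimately show ?thesis
      unfolding j by (auto simp: sign_pairs_def signed_sum_def)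
  qed
qed

section \<open>Exact integrals of products of Chebyshev basis functions\<close>

text \<open>
  The four terms agree in pairs because \<open>cos\<close> is even. Averaging over all four, and not
  over the two different ones, makes the weight independent of whether \<open>k\<close> or \<open>l\<close> vanishes.
\<close>

lemma cos_mult_cos_eq_sum_cos:
  "cos (real k * t) * cos (real l * t)
     = (\<Sum>p\<in>sign_pairs. cos (of_int (signed_sum k l p) * t)) / 4"
proof -
  have "cos (- (real k * t) - real l * t) = cos (real k * t + real l * t)"
    by (metis cos_minus minus_add_distrib uminus_add_conv_diff add.commute)
  moreover have "cos (real l * t - real k * t) = cos (real k * t - real l * t)"
    by (metis cos_minus minus_diff_eq)
  ultimately show ?thesis
    by (simp add: sum_sign_pairs signed_sum_def distrib_right left_diff_distrib cos_times_cos)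
qed

text \<open>
  The integrand has a primitive that is continuous up to the end points, where the weight is
  singular: \<open>- sin (m arccos x) / (m \<pi>)\<close>, and \<open>- arccos x / \<pi>\<close> for \<open>m = 0\<close>.
\<close>

lemma has_integral_cos_arccos_weight:
  fixes m :: int
  shows "((\<lambda>x. cos (of_int m * arccos x) / (pi * sqrt (1 - x\<^sup>2))) has_integral of_bool (m = 0)) {-1..1}"
proof -
  define F where "F x = (if m = 0 then - arccos x / pi
                         else - sin (of_int m * arccos x) / (of_int m * pi))" for x
  have "((\<lambda>x. cos (of_int m * arccos x) / (pi * sqrt (1 - x\<^sup>2))) has_integral (F 1 - F (-1))) {-1..1}"
  proof (rule fundamental_theorem_of_calculus_interior)
    show "continuous_on {-1..1} F"
      unfolding F_def by (cases "m = 0") (auto intro!: continuous_intros)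
    fix x :: real assume x: "x \<in> {-1<..<1}"
    then have "x\<^sup>2 < 1"
      by (simp add: abs_square_less_1 abs_less_iff)
    then have "sqrt (1 - x\<^sup>2) \<noteq> 0" by simp
    then have "(F has_real_derivative cos (of_int m * arccos x) / (pi * sqrt (1 - x\<^sup>2))) (at x)"
      unfolding F_def using x
      by (cases "m = 0") (auto intro!: derivative_eq_intros simp: field_simps)
    then show "(F has_vector_derivative cos (of_int m * arccos x) / (pi * sqrt (1 - x\<^sup>2))) (at x)"
      by (simp add: has_real_derivative_iff_has_vector_derivative)
  qed simp
  moreover have "F 1 - F (-1) = of_bool (m = 0)"
    using sin_npi_int[of m] by (simp add: F_def mult.commute[of pi])
  ultimately show ?thesis by simp
qed

abbreviation interval_measure :: "real measure" where
  "interval_measure \<equiv> restrict_space lborel {-1..1}"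

lemma measurable_cos_arccos_weight:
  fixes a :: real
  shows "(\<lambda>x. cos (a * arccos x) / (pi * sqrt (1 - x\<^sup>2))) \<in> borel_measurable interval_measure"
proof -
  have "(\<lambda>x. cos (a * arccos x)) \<in> borel_measurable (restrict_space borel {-1..1})"
    by (rule borel_measurable_continuous_on_restrict) (auto intro!: continuous_intros)
  then have "(\<lambda>x. cos (a * arccos x)) \<in> borel_measurable interval_measure"
    by (simp cong: measurable_cong_sets add: sets_restrict_space)
  moreover have "(\<lambda>x. pi * sqrt (1 - x\<^sup>2)) \<in> borel_measurable interval_measure"
    by (rule measurable_restrict_space1) simp
  ultimately show ?thesis
    by simp
qed

lemma sqrt_weight_nonneg: "x \<in> {-1..1} \<Longrightarrow> 0 \<le> sqrt (1 - x\<^sup>2)" for x :: real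
  by (simp add: abs_square_le_1 abs_le_iff)

text \<open>
  The Lebesgue version. Convergence of the gauge integral does not give absolute integrability;
  that comes from the weight itself, the nonnegative case \<open>m = 0\<close>, which dominates all others.
\<close>

lemma has_bochner_integral_cos_arccos_weight:
  fixes m :: int
  shows "has_bochner_integral interval_measure
           (\<lambda>x. cos (of_int m * arccos x) / (pi * sqrt (1 - x\<^sup>2))) (of_bool (m = 0))"
proof -
  let ?g = "\<lambda>m x. indicator {-1..1} x *\<^sub>R (cos (of_int m * arccos x) / (pi * sqrt (1 - x\<^sup>2)))"
  have meas: "?g m \<in> borel_measurable lborel" for m :: int
    using measurable_cos_arccos_weight[of "of_int m"] by (subst (asm) borel_measurable_restrict_space_iff) simp_all
  have HK: "(?g m has_integral of_bool (m = 0)) UNIV" for m :: int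
  proof -
    have "?g m = (\<lambda>x. if x \<in> {-1..1} then cos (of_int m * arccos x) / (pi * sqrt (1 - x\<^sup>2)) else 0)"
      by (auto simp: indicator_def)
    then show ?thesis
      using has_integral_cos_arccos_weight[of m] by (simp only: has_integral_restrict_UNIV)
  qed
  have nonneg: "0 \<le> ?g 0 x" for x
    using sqrt_weight_nonneg[of x] by (auto simp: indicator_def)
  have "(\<integral>\<^sup>+x. ennreal (?g 0 x) \<partial>lborel) = ennreal (of_bool ((0::int) = 0))"
    by (rule nn_integral_has_integral_lborel[OF _ nonneg HK]) (use meas[of 0] in simp)
  then have int0: "integrable lborel (?g 0)"
    by (intro integrableI_nn_integral_finite[OF meas] AE_I2 nonneg)
  have int: "integrable lborel (?g m)"
  proof (rule Bochner_Integration.integrable_bound[OF int0 meas], intro AE_I2)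
    fix x :: real
    show "norm (?g m x) \<le> norm (?g 0 x)"
      by (cases "x \<in> {-1..1}") (simp_all add: divide_right_mono)
  qed
  then have "integral\<^sup>L lborel (?g m) = of_bool (m = 0)"
    using has_integral_unique[OF has_integral_integral_lborel[OF int] HK] by simp
  with int have "has_bochner_integral lborel (?g m) (of_bool (m = 0))"
    by (simp only: has_bochner_integral_iff)
  then show ?thesis
    by (subst has_bochner_integral_restrict_space) simp_all
qed

lemma has_bochner_integral_cheb_T_mult:
  "has_bochner_integral interval_measure
     (\<lambda>x. cheb_T k x * cheb_T l x / (pi * sqrt (1 - x\<^sup>2)))
     ((\<Sum>p\<in>sign_pairs. of_bool (signed_sum k l p = 0)) / 4)"
proof -
  have "has_bochner_integral interval_measure
     (\<lambda>x. (\<Sum>p\<in>sign_pairs. cos (of_int (signed_sum k l p) * arccos x) / (pi * sqrt (1 - x\<^sup>2))) / 4)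
     ((\<Sum>p\<in>sign_pairs. of_bool (signed_sum k l p = 0)) / 4)"
    by (rule has_bochner_integral_divide_zero)
       (rule has_bochner_integral_sum, rule has_bochner_integral_cos_arccos_weight)
  also have "(\<lambda>x. (\<Sum>p\<in>sign_pairs. cos (of_int (signed_sum k l p) * arccos x) / (pi * sqrt (1 - x\<^sup>2))) / 4)
     = (\<lambda>x. cheb_T k x * cheb_T l x / (pi * sqrt (1 - x\<^sup>2)))"
    unfolding cheb_T_def cos_mult_cos_eq_sum_cos sum_divide_distrib[symmetric]
    by (simp only: divide_divide_eq_left mult.commute)
  finally show ?thesis .
qed

lemma space_cheb_measure [simp]: "space (cheb_measure d) = {..<d} \<rightarrow>\<^sub>E {-1..1}"
  by (simp add: cheb_measure_def space_PiM space_restrict_space)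

lemma measurable_cheb_basis:
  assumes "length k = d"
  shows "cheb_basis k \<in> borel_measurable (\<Pi>\<^sub>M j\<in>{..<d}. interval_measure)"
proof -
  have "(\<lambda>x. cos (real m * arccos x)) \<in> borel_measurable (restrict_space borel {-1..1})" for m
    by (rule borel_measurable_continuous_on_restrict) (auto intro!: continuous_intros)
  then have [measurable]: "cheb_T m \<in> borel_measurable interval_measure" for m
    unfolding cheb_T_def[abs_def] by (simp cong: measurable_cong_sets add: sets_restrict_space)
  show ?thesis
    unfolding cheb_basis_def[abs_def] assms by measurable
qed

text \<open>
  The integral factorises over the coordinates, each factor counts the sign pairs with sum zero,
  and multiplying out counts the sign choices for which every coordinate vanishes.
\<close>

lemma has_bochner_integral_cheb_basis_mult:
  assumes k: "length k = d" and l: "length l = d"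
  shows "has_bochner_integral (cheb_measure d) (\<lambda>x. cheb_basis k x * cheb_basis l x)
     (sqrt 2 ^ (num_nonzero k + num_nonzero l)
        * card {\<rho>\<in>sign_choices d. signed_sums k l \<rho> = replicate d 0} / 4 ^ d)"
proof -
  define c :: real where "c = sqrt 2 ^ (num_nonzero k + num_nonzero l)"
  define w :: "(nat \<Rightarrow> real) \<Rightarrow> real" where "w x = 1 / (\<Prod>j<d. pi * sqrt (1 - (x j)\<^sup>2))" for x
  define g :: "nat \<Rightarrow> real \<Rightarrow> real"
    where "g j t = cheb_T (k ! j) t * cheb_T (l ! j) t / (pi * sqrt (1 - t\<^sup>2))" for j t
  let ?M = "\<Pi>\<^sub>M j\<in>{..<d}. interval_measure"
  interpret product_sigma_finite "\<lambda>_::nat. interval_measure"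
    by (simp add: product_sigma_finite_def sigma_finite_measure_restrict_space sigma_finite_lborel)
  have g: "integrable interval_measure (g j)"
          "integral\<^sup>L interval_measure (g j)
             = (\<Sum>p\<in>sign_pairs. of_bool (signed_sum (k ! j) (l ! j) p = 0)) / 4" for j
    using has_bochner_integral_cheb_T_mult[of "k ! j" "l ! j"]
    unfolding g_def has_bochner_integral_iff by blast+
  have [measurable]: "(\<lambda>t::real. t) \<in> borel_measurable interval_measure"
    by (rule measurable_restrict_space1) simp
  have w_meas: "w \<in> borel_measurable ?M"
    unfolding w_def by measurable
  have w_nonneg: "0 \<le> w x" if "x \<in> space ?M" for x
    using that unfolding w_def
    by (auto intro!: divide_nonneg_nonneg prod_nonneg mult_nonneg_nonneg sqrt_weight_nonneg
        simp: space_PiM space_restrict_space PiE_iff simp del: real_sqrt_ge_0_iff)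
  have b_meas: "(\<lambda>x. cheb_basis k x * cheb_basis l x) \<in> borel_measurable ?M"
    using measurable_cheb_basis[OF k] measurable_cheb_basis[OF l] by simp
  have eq: "w x * (cheb_basis k x * cheb_basis l x) = c * (\<Prod>j<d. g j (x j))" for x
    by (simp add: w_def g_def c_def cheb_basis_def k l prod.distrib prod_dividef power_add)
  have cheb: "cheb_measure d = density ?M w"
    by (simp add: cheb_measure_def w_def)
  have prod: "integrable ?M (\<lambda>x. \<Prod>j<d. g j (x j))"
    by (rule product_integrable_prod) (auto simp: g)
  have "integrable (cheb_measure d) (\<lambda>x. cheb_basis k x * cheb_basis l x)"
    unfolding cheb using w_nonneg prod
    by (subst integrable_density[OF b_meas w_meas]) (auto intro!: AE_I2 simp: eq)
  moreover have "(\<integral>x. cheb_basis k x * cheb_basis l x \<partial>cheb_measure d)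
      = c * card {\<rho>\<in>sign_choices d. signed_sums k l \<rho> = replicate d 0} / 4 ^ d"
  proof -
    have zero: "(\<Prod>j<d. of_bool (signed_sum (k ! j) (l ! j) (\<rho> j) = 0))
        = (of_bool (signed_sums k l \<rho> = replicate d 0) :: real)" for \<rho>
      using signed_sums_eq_zero_iff[of k l \<rho>] k by (auto simp: of_bool_def)
    have "(\<integral>x. cheb_basis k x * cheb_basis l x \<partial>cheb_measure d)
        = c * (\<integral>x. (\<Prod>j<d. g j (x j)) \<partial>?M)"
      unfolding cheb using w_nonneg
      by (subst integral_density[OF b_meas w_meas]) (auto intro!: AE_I2 simp: eq)
    also have "(\<integral>x. (\<Prod>j<d. g j (x j)) \<partial>?M)
        = (\<Prod>j<d. (\<Sum>p\<in>sign_pairs. of_bool (signed_sum (k ! j) (l ! j) p = 0)) / 4)"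
      by (subst product_integral_prod) (auto simp: g)
    also have "\<dots> = (\<Sum>\<rho>\<in>sign_choices d. of_bool (signed_sums k l \<rho> = replicate d 0)) / 4 ^ d"
      unfolding prod_sum_sign_choices zero ..
    also have "\<dots> = card {\<rho>\<in>sign_choices d. signed_sums k l \<rho> = replicate d 0} / 4 ^ d"
      by (simp add: sum_of_bool_eq Int_def)
    finally show ?thesis by simp
  qed
  ultimately show ?thesis
    by (simp add: has_bochner_integral_iff c_def)
qed

section \<open>Lattice rules applied to products of Chebyshev basis functions\<close>

text \<open>
  \<open>cos (k t)\<close> is a polynomial in \<open>cos t\<close>. This lets \<open>arccos (cos t)\<close> be replaced by \<open>t\<close> and the
  tent-transformed angle be unfolded, without reducing the angle to \<open>[0, \<pi>]\<close>.
\<close>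

lemma cos_mult_cong:
  assumes "cos s = cos t"
  shows "cos (real k * s) = cos (real k * t)"
proof (induction k rule: induct_nat_012)
  case (ge2 k)
  have step: "cos (real (Suc (Suc k)) * x) = 2 * cos x * cos (real (Suc k) * x) - cos (real k * x)" for x
  proof -
    have "cos (real (Suc k) * x + x) + cos (real (Suc k) * x - x) = 2 * cos x * cos (real (Suc k) * x)"
      by (simp add: cos_add cos_diff)
    moreover have "real (Suc k) * x + x = real (Suc (Suc k)) * x" "real (Suc k) * x - x = real k * x"
      by (simp_all add: algebra_simps)
    ultimately show ?thesis by simp
  qed
  show ?case
    unfolding step using ge2 assms by simp
qed (use assms in simp_all)

lemma cheb_T_cos: "cheb_T k (cos t) = cos (real k * t)"
  unfolding cheb_T_def by (rule cos_mult_cong) simp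

text \<open>
  The tent transform only reflects the angle: \<open>\<pi> tent x\<close> is \<open>2 \<pi> x\<close> or \<open>2 \<pi> - 2 \<pi> x\<close>.
\<close>

lemma cos_tent:
  assumes "0 \<le> x" "x \<le> 1"
  shows "cos (pi * real k * tent x) = cos (real k * (2 * pi * x))"
proof -
  have "cos (pi * tent x) = cos (2 * pi * x)"
  proof (cases "x \<le> 1 / 2")
    case False
    then have "pi * tent x = 2 * pi - 2 * pi * x"
      by (simp add: tent_def algebra_simps)
    then show ?thesis by simp
  qed (simp add: tent_def mult.commute mult.left_commute)
  from cos_mult_cong[OF this, of k] show ?thesis
    by (simp only: mult_ac)
qed

text \<open>
  A geometric sum of powers of an \<open>n\<close>-th root of unity, which is \<open>1\<close> iff \<open>n\<close> divides \<open>m\<close>.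
\<close>

lemma sum_cis_lattice:
  assumes "n \<ge> 1"
  shows "(\<Sum>i<n. cis (2 * pi * of_int (int i * m) / real n)) = of_bool ([m = 0] (mod int n)) * of_nat n"
proof -
  define w where "w = cis (2 * pi * of_int m / real n)"
  have pow: "cis (2 * pi * of_int (int i * m) / real n) = w ^ i" for i
  proof -
    have "2 * pi * of_int (int i * m) / real n = real i * (2 * pi * of_int m / real n)"
      by simp
    then show ?thesis
      by (simp only: w_def Complex.DeMoivre)
  qed
  have "w ^ n = cis (2 * pi * of_int m)"
    using assms by (simp add: w_def Complex.DeMoivre)
  then have wn: "w ^ n = 1"
    by (simp add: cis_multiple_2pi)
  have "w = 1 \<longleftrightarrow> [m = 0] (mod int n)"
  proof
    assume "w = 1"
    then have "cos (2 * pi * of_int m / real n) = 1"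
      by (metis w_def cis.simps(1) one_complex.simps(1))
    then obtain q :: int where "2 * pi * of_int m / real n = of_int q * 2 * pi"
      by (auto simp: cos_one_2pi_int)
    then have "(of_int m :: real) = of_int (q * int n)"
      using assms by (simp add: field_simps)
    then have "m = q * int n"
      by (simp only: of_int_eq_iff)
    then show "[m = 0] (mod int n)"
      by (simp add: cong_0_iff)
  next
    assume "[m = 0] (mod int n)"
    then obtain q where "m = int n * q"
      by (auto simp: cong_0_iff)
    then have "2 * pi * of_int m / real n = 2 * pi * of_int q"
      using assms by simp
    then show "w = 1"
      by (simp only: w_def cis_multiple_2pi Ints_of_int)
  qed
  moreover have "(\<Sum>i<n. w ^ i) = of_bool (w = 1) * of_nat n"
    using wn by (cases "w = 1") (simp_all add: geometric_sum)
  ultimately show ?thesis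
    by (simp only: pow)
qed

text \<open>
  The real identity lifted to characters, which unlike cosines multiply across coordinates;
  the sines cancel in pairs.
\<close>

lemma cos_mult_cos_eq_sum_cis:
  "complex_of_real (cos (real k * t) * cos (real l * t))
     = (\<Sum>p\<in>sign_pairs. cis (of_int (signed_sum k l p) * t)) / 4"
proof (rule complex_eqI)
  show "Re (complex_of_real (cos (real k * t) * cos (real l * t)))
      = Re ((\<Sum>p\<in>sign_pairs. cis (of_int (signed_sum k l p) * t)) / 4)"
    by (simp only: cos_mult_cos_eq_sum_cos Re_sum cis.simps Re_divide_numeral Re_complex_of_real)
  have "sin (- (real k * t) - real l * t) = - sin (real k * t + real l * t)"
    by (simp add: sin_add sin_diff)
  moreover have "sin (real l * t - real k * t) = - sin (real k * t - real l * t)"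
    by (simp add: sin_diff)
  ultimately show "Im (complex_of_real (cos (real k * t) * cos (real l * t)))
      = Im ((\<Sum>p\<in>sign_pairs. cis (of_int (signed_sum k l p) * t)) / 4)"
    by (simp add: sum_sign_pairs signed_sum_def distrib_right left_diff_distrib)
qed

lemma prod_cis: "finite I \<Longrightarrow> (\<Prod>j\<in>I. cis (f j)) = cis (\<Sum>j\<in>I. f j)"
  by (induction I rule: finite_induct) (simp_all add: cis_mult)

text \<open>
  Integer frequencies do not notice the reduction of the lattice points to the unit cube.
\<close>

lemma cis_mod:
  assumes "n \<ge> 1"
  shows "cis (of_int h * (2 * pi * (of_int (a mod int n) / real n))) = cis (2 * pi * of_int (h * a) / real n)"
proof -
  have "a = int n * (a div int n) + a mod int n"
    by simp
  then have "(of_int a :: real) = real n * of_int (a div int n) + of_int (a mod int n)"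
    by (metis of_int_add of_int_mult of_int_of_nat_eq)
  then have "2 * pi * of_int (h * a) / real n
      = of_int h * (2 * pi * (of_int (a mod int n) / real n)) + 2 * pi * of_int (h * (a div int n))"
    using assms by (simp add: field_simps)
  then show ?thesis
    by (simp only: cis_mult[symmetric] cis_multiple_2pi Ints_of_int mult_1_right)
qed

text \<open>
  Discrete counterpart of \<open>has_bochner_integral_cheb_basis_mult\<close>: after multiplying out,
  each character is averaged over the lattice and survives iff its frequency lies in the dual
  lattice of \<open>z\<close>.
\<close>

lemma approx_coeff_cheb_basis:
  assumes n: "n \<ge> 1" and z: "length z = d" and k: "length k = d" and l: "length l = d"
  shows "approx_coeff d n z (cheb_basis l) k
     = sqrt 2 ^ (num_nonzero k + num_nonzero l)
        * card {\<rho>\<in>sign_choices d. [dot (signed_sums k l \<rho>) z = 0] (mod int n)} / 4 ^ d"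
proof -
  define c :: real where "c = sqrt 2 ^ (num_nonzero k + num_nonzero l)"
  define \<theta> where "\<theta> i j = 2 * pi * (of_int ((int i * z ! j) mod int n) / real n)" for i j
  let ?h = "\<lambda>\<rho>. dot (signed_sums k l \<rho>) z"
  have "complex_of_real (\<Prod>j<d. cos (real (k ! j) * \<theta> i j) * cos (real (l ! j) * \<theta> i j))
      = (\<Sum>\<rho>\<in>sign_choices d. cis (2 * pi * of_int (int i * ?h \<rho>) / real n)) / 4 ^ d" for i
  proof -
    have "(\<Prod>j<d. cis (of_int (signed_sum (k ! j) (l ! j) (\<rho> j)) * \<theta> i j))
        = cis (2 * pi * of_int (int i * ?h \<rho>) / real n)" for \<rho>
    proof -
      have "(\<Prod>j<d. cis (of_int (signed_sum (k ! j) (l ! j) (\<rho> j)) * \<theta> i j))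
          = (\<Prod>j<d. cis (2 * pi * of_int (signed_sum (k ! j) (l ! j) (\<rho> j) * (int i * z ! j)) / real n))"
        unfolding \<theta>_def cis_mod[OF n] ..
      also have "\<dots> = cis (2 * pi * of_int (int i * ?h \<rho>) / real n)"
        by (simp add: prod_cis dot_def z signed_sums_def k sum_distrib_left sum_divide_distrib mult_ac)
      finally show ?thesis .
    qed
    then show ?thesis
      by (simp only: of_real_prod cos_mult_cos_eq_sum_cis prod_sum_sign_choices)
  qed
  then have "complex_of_real (\<Sum>i<n. \<Prod>j<d. cos (real (k ! j) * \<theta> i j) * cos (real (l ! j) * \<theta> i j))
      = (\<Sum>i<n. \<Sum>\<rho>\<in>sign_choices d. cis (2 * pi * of_int (int i * ?h \<rho>) / real n)) / 4 ^ d"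
    by (simp only: of_real_sum sum_divide_distrib)
  also have "\<dots> = (\<Sum>\<rho>\<in>sign_choices d. of_bool ([?h \<rho> = 0] (mod int n)) * of_nat n) / 4 ^ d"
    by (subst sum.swap) (simp only: sum_cis_lattice[OF n])
  also have "\<dots> = of_nat (card {\<rho>\<in>sign_choices d. [?h \<rho> = 0] (mod int n)} * n) / 4 ^ d"
    by (simp add: sum_distrib_right[symmetric] Int_def)
  also have "\<dots> = complex_of_real (card {\<rho>\<in>sign_choices d. [?h \<rho> = 0] (mod int n)} * n / 4 ^ d)"
    by simp
  finally have sum: "(\<Sum>i<n. \<Prod>j<d. cos (real (k ! j) * \<theta> i j) * cos (real (l ! j) * \<theta> i j))
      = card {\<rho>\<in>sign_choices d. [?h \<rho> = 0] (mod int n)} * n / 4 ^ d"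
    by (simp only: of_real_eq_iff)
  \<comment> \<open>The lattice points lie in the unit cube, so the tent transform can be unfolded.\<close>
  have tent: "cos (pi * real m * tent (of_int ((int i * z ! j) mod int n) / real n)) = cos (real m * \<theta> i j)" for m i j
  proof -
    have "(int i * z ! j) mod int n < int n"
      using n by simp
    then have "(of_int ((int i * z ! j) mod int n) :: real) \<le> real n"
      by linarith
    then show ?thesis
      unfolding \<theta>_def using n by (intro cos_tent) auto
  qed
  have "cheb_basis l (\<lambda>j\<in>{..<d}. cos (2 * pi * (\<lambda>j\<in>{..<length z}. real_of_int ((int i * z ! j) mod int n) / real n) j))
      * cos_basis k (\<lambda>j\<in>{..<d}. tent ((\<lambda>j\<in>{..<length z}. real_of_int ((int i * z ! j) mod int n) / real n) j))
      = c * (\<Prod>j<d. cos (real (k ! j) * \<theta> i j) * cos (real (l ! j) * \<theta> i j))" for i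
  proof -
    let ?x = "\<lambda>j\<in>{..<length z}. real_of_int ((int i * z ! j) mod int n) / real n"
    have "cheb_basis l (\<lambda>j\<in>{..<d}. cos (2 * pi * ?x j))
        = sqrt 2 ^ num_nonzero l * (\<Prod>j<d. cos (real (l ! j) * \<theta> i j))"
      by (simp add: cheb_basis_def l z cheb_T_cos \<theta>_def)
    moreover have "cos_basis k (\<lambda>j\<in>{..<d}. tent (?x j))
        = sqrt 2 ^ num_nonzero k * (\<Prod>j<d. cos (real (k ! j) * \<theta> i j))"
      by (simp add: cos_basis_def k z tent)
    ultimately show ?thesis
      by (simp add: c_def power_add prod.distrib)
  qed
  then have "approx_coeff d n z (cheb_basis l) k
      = 1 / real n * (\<Sum>i<n. c * (\<Prod>j<d. cos (real (k ! j) * \<theta> i j) * cos (real (l ! j) * \<theta> i j)))"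
    by (simp only: approx_coeff_def lattice_rule_def)
  also have "\<dots> = c * card {\<rho>\<in>sign_choices d. [?h \<rho> = 0] (mod int n)} / 4 ^ d"
    using n by (simp add: sum_distrib_left[symmetric] sum)
  finally show ?thesis
    by (simp add: c_def)
qed

section \<open>Reconstruction on the span of the basis\<close>

text \<open>
  Both sides are the same positive multiple of a cardinality, and the sign choices counted by the
  integral are among those counted by the lattice rule. Equal cardinality therefore forces equal
  sets.
\<close>

lemma coeffs_agree_iff:
  assumes n: "n \<ge> 1" and z: "length z = d" and k: "length k = d" and l: "length l = d"
  shows "cheb_coeff d (cheb_basis l) k = approx_coeff d n z (cheb_basis l) k
     \<longleftrightarrow> (\<forall>\<rho>\<in>sign_choices d. [dot (signed_sums k l \<rho>) z = 0] (mod int n)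
            \<longrightarrow> signed_sums k l \<rho> = replicate d 0)"
proof -
  let ?Z = "{\<rho>\<in>sign_choices d. signed_sums k l \<rho> = replicate d 0}"
  let ?N = "{\<rho>\<in>sign_choices d. [dot (signed_sums k l \<rho>) z = 0] (mod int n)}"
  have "cheb_coeff d (cheb_basis l) k = sqrt 2 ^ (num_nonzero k + num_nonzero l) * card ?Z / 4 ^ d"
    using has_bochner_integral_cheb_basis_mult[OF k l]
    by (simp add: cheb_coeff_def has_bochner_integral_iff mult.commute)
  then have "cheb_coeff d (cheb_basis l) k = approx_coeff d n z (cheb_basis l) k \<longleftrightarrow> card ?Z = card ?N"
    unfolding approx_coeff_cheb_basis[OF assms] by simp
  moreover have sub: "?Z \<subseteq> ?N"
    using z by (auto simp: dot_def)
  moreover have "card ?Z = card ?N \<longleftrightarrow> ?Z = ?N"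
    using card_subset_eq[OF _ sub] by auto
  ultimately show ?thesis
    by blast
qed

lemma cheb_coeff_expansion:
  assumes "finite \<Lambda>" and len: "\<forall>k\<in>\<Lambda>. length k = d" and k: "k \<in> \<Lambda>"
    and f: "\<forall>x \<in> {..<d} \<rightarrow>\<^sub>E {-1..1}. f x = (\<Sum>l\<in>\<Lambda>. c l * cheb_basis l x)"
  shows "cheb_coeff d f k = (\<Sum>l\<in>\<Lambda>. c l * cheb_coeff d (cheb_basis l) k)"
proof -
  have int: "integrable (cheb_measure d) (\<lambda>x. cheb_basis l x * cheb_basis k x)" if "l \<in> \<Lambda>" for l
    using has_bochner_integral_cheb_basis_mult[of l d k] that len k
    by (simp add: has_bochner_integral_iff)
  have "cheb_coeff d f k = (\<integral>x. (\<Sum>l\<in>\<Lambda>. c l * (cheb_basis l x * cheb_basis k x)) \<partial>cheb_measure d)"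
    unfolding cheb_coeff_def using f
    by (intro Bochner_Integration.integral_cong) (simp_all add: sum_distrib_right mult.assoc)
  also have "\<dots> = (\<Sum>l\<in>\<Lambda>. c l * cheb_coeff d (cheb_basis l) k)"
    unfolding cheb_coeff_def using int
    by (subst Bochner_Integration.integral_sum) simp_all
  finally show ?thesis .
qed

lemma approx_coeff_expansion:
  assumes f: "\<forall>x \<in> {..<d} \<rightarrow>\<^sub>E {-1..1}. f x = (\<Sum>l\<in>\<Lambda>. c l * cheb_basis l x)"
  shows "approx_coeff d n z f k = (\<Sum>l\<in>\<Lambda>. c l * approx_coeff d n z (cheb_basis l) k)"
proof -
  define p where "p i = (\<lambda>j\<in>{..<length z}. real_of_int ((int i * z ! j) mod int n) / real n)" for i
  define x where "x i = (\<lambda>j\<in>{..<d}. cos (2 * pi * p i j))" for i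
  define q where "q i = cos_basis k (\<lambda>j\<in>{..<d}. tent (p i j))" for i
  have approx: "approx_coeff d n z g k = 1 / real n * (\<Sum>i<n. g (x i) * q i)" for g
    unfolding approx_coeff_def lattice_rule_def p_def x_def q_def ..
  have "x i \<in> {..<d} \<rightarrow>\<^sub>E {-1..1}" for i
    by (auto simp: x_def)
  then have "approx_coeff d n z f k = 1 / real n * (\<Sum>i<n. \<Sum>l\<in>\<Lambda>. c l * cheb_basis l (x i) * q i)"
    unfolding approx using f by (simp add: sum_distrib_right)
  also have "\<dots> = (\<Sum>l\<in>\<Lambda>. c l * approx_coeff d n z (cheb_basis l) k)"
    unfolding approx by (subst sum.swap) (simp add: sum_distrib_left mult_ac)
  finally show ?thesis .
qed

lemma reconstruction_iff_basis:
  assumes fin: "finite \<Lambda>" and len: "\<forall>k\<in>\<Lambda>. length k = d"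
  shows "(\<forall>f \<in> cheb_space d \<Lambda>. \<forall>k\<in>\<Lambda>. cheb_coeff d f k = approx_coeff d n z f k)
     \<longleftrightarrow> (\<forall>k\<in>\<Lambda>. \<forall>l\<in>\<Lambda>. cheb_coeff d (cheb_basis l) k = approx_coeff d n z (cheb_basis l) k)"
proof (intro iffI ballI)
  fix k l
  assume "\<forall>f \<in> cheb_space d \<Lambda>. \<forall>k\<in>\<Lambda>. cheb_coeff d f k = approx_coeff d n z f k"
    and kl: "k \<in> \<Lambda>" "l \<in> \<Lambda>"
  moreover have "cheb_basis l \<in> cheb_space d \<Lambda>"
  proof -
    have "(\<Sum>m\<in>\<Lambda>. (if m = l then 1 else 0) * cheb_basis m x) = (\<Sum>m\<in>\<Lambda>. if m = l then cheb_basis m x else 0)" for x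
      by (intro sum.cong) auto
    also have "\<dots> x = cheb_basis l x" for x
      using fin kl by simp
    finally show ?thesis
      unfolding cheb_space_def by (intro CollectI exI[of _ "\<lambda>m. if m = l then 1 else 0"]) simp
  qed
  ultimately show "cheb_coeff d (cheb_basis l) k = approx_coeff d n z (cheb_basis l) k"
    by blast
next
  fix f k
  assume basis: "\<forall>k\<in>\<Lambda>. \<forall>l\<in>\<Lambda>. cheb_coeff d (cheb_basis l) k = approx_coeff d n z (cheb_basis l) k"
    and "f \<in> cheb_space d \<Lambda>" and k: "k \<in> \<Lambda>"
  then obtain c where f: "\<forall>x \<in> {..<d} \<rightarrow>\<^sub>E {-1..1}. f x = (\<Sum>l\<in>\<Lambda>. c l * cheb_basis l x)"
    unfolding cheb_space_def by blast
  show "cheb_coeff d f k = approx_coeff d n z f k"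
    unfolding cheb_coeff_expansion[OF fin len k f] approx_coeff_expansion[OF f]
    using basis k by (intro sum.cong) auto
qed

lemma reconstruction_iff_nonvanishing:
  assumes fin: "finite \<Lambda>" and len: "\<forall>k\<in>\<Lambda>. length k = d"
    and n: "n \<ge> 1" and z: "length z = d"
  shows "(\<forall>f \<in> cheb_space d \<Lambda>. \<forall>k\<in>\<Lambda>. cheb_coeff d f k = approx_coeff d n z f k)
     \<longleftrightarrow> nonvanishing n (set_sum (mirror \<Lambda>) (mirror \<Lambda>)) z"
proof -
  have agree: "cheb_coeff d (cheb_basis l) k = approx_coeff d n z (cheb_basis l) k
     \<longleftrightarrow> (\<forall>\<rho>\<in>sign_choices d. [dot (signed_sums k l \<rho>) z = 0] (mod int n)
            \<longrightarrow> signed_sums k l \<rho> = replicate d 0)" if "k \<in> \<Lambda>" "l \<in> \<Lambda>" for k l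
    using coeffs_agree_iff[OF n z] that len by blast
  have "(\<forall>f \<in> cheb_space d \<Lambda>. \<forall>k\<in>\<Lambda>. cheb_coeff d f k = approx_coeff d n z f k)
     \<longleftrightarrow> (\<forall>k\<in>\<Lambda>. \<forall>l\<in>\<Lambda>. \<forall>\<rho>\<in>sign_choices d. [dot (signed_sums k l \<rho>) z = 0] (mod int n)
            \<longrightarrow> signed_sums k l \<rho> = replicate d 0)"
    unfolding reconstruction_iff_basis[OF fin len] by (simp add: agree cong: ball_cong)
  also have "\<dots> \<longleftrightarrow> nonvanishing n (set_sum (mirror \<Lambda>) (mirror \<Lambda>)) z"
    unfolding nonvanishing_def set_sum_mirror[OF len] z by blast
  finally show ?thesis .
qed

section \<open>Component-by-component construction\<close>

lemma dot_snoc: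
  assumes "length h = length zs"
  shows "dot (h @ [x]) (zs @ [z]) = dot h zs + x * z"
  using assms by (simp add: dot_def nth_append)

lemma dot_uminus:
  assumes "length h = length z"
  shows "dot (map uminus h) z = - dot h z"
  using assms by (simp add: dot_def sum_negf)

text \<open>
  A vector with last component \<open>x\<close> not divisible by \<open>n\<close> excludes at most one residue.
\<close>

lemma cong_cancel_residue:
  fixes x z z' :: int
  assumes "prime n" and x: "0 < x" "x < int n"
    and z: "z \<in> {1..int n - 1}" "z' \<in> {1..int n - 1}"
    and "[a + x * z = 0] (mod int n)" "[a + x * z' = 0] (mod int n)"
  shows "z = z'"
proof -
  have "int n dvd x * (z - z')"
    using cong_diff[OF assms(6,7)] by (simp add: cong_0_iff right_diff_distrib)
  moreover have "\<not> int n dvd x"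
    using x zdvd_imp_le by force
  ultimately have "int n dvd z - z'"
    using \<open>prime n\<close> by (simp add: prime_dvd_mult_iff)
  then show ?thesis
    using z dvd_imp_le_int[of "z - z'" "int n"] by (cases "z = z'") auto
qed

text \<open>
  The step of the construction, for an arbitrary symmetric set \<open>Q\<close> of vectors with one component
  more than those in \<open>P\<close>; both kinds of projection are instances. A residue \<open>z\<close> is bad if some
  \<open>h \<in> Q\<close> with positive last component vanishes at it. Vectors with negative last component give
  the same bad residues, and those with last component zero are handled by \<open>P\<close>.
\<close>

lemma nonvanishing_extension:
  fixes P Q :: "int list set"
  assumes n: "prime n"
    and Q: "finite Q" "\<And>h. h \<in> Q \<Longrightarrow> length h = Suc (length zs)"
    and neg: "\<And>h. h \<in> Q \<Longrightarrow> map uminus h \<in> Q"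
    and zero: "Q \<noteq> {} \<Longrightarrow> replicate (Suc (length zs)) 0 \<in> Q"
    and bound: "\<And>h x. h \<in> Q \<Longrightarrow> x \<in> set h \<Longrightarrow> \<bar>x\<bar> < int n"
    and card: "card Q + 1 < 2 * n"
    and proj: "\<And>h. h @ [0] \<in> Q \<Longrightarrow> h \<in> P"
    and P: "nonvanishing n P zs"
  shows "\<exists>z\<in>{1..int n - 1}. nonvanishing n Q (zs @ [z])"
proof -
  define Pos where "Pos = {h\<in>Q. 0 < last h}"
  define Neg where "Neg = {h\<in>Q. last h < 0}"
  define bad where "bad = {z\<in>{1..int n - 1}. \<exists>h\<in>Pos. [dot h (zs @ [z]) = 0] (mod int n)}"
  have snoc: "\<exists>h' x. h = h' @ [x] \<and> length h' = length zs" if "h \<in> Q" for h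
    using Q(2)[OF that] by (metis length_Suc_conv_rev)
  have last_neg: "last (map uminus h) = - last h" if "h \<in> Q" for h :: "int list"
    using snoc[OF that] by auto
  have "n \<ge> 2"
    using n by (rule prime_ge_2_nat)
  have "card Pos < n - 1"
  proof (cases "Q = {}")
    case True
    with \<open>n \<ge> 2\<close> show ?thesis by (simp add: Pos_def)
  next
    case False
    let ?zero = "replicate (Suc (length zs)) (0::int)"
    have fin: "finite Pos" "finite Neg"
      using Q(1) by (auto simp: Pos_def Neg_def)
    \<comment> \<open>\<open>Pos\<close>, its mirror image and the zero vector are disjoint parts of \<open>Q\<close>.\<close>
    have "card Pos = card (map uminus ` Pos)"
      by (rule card_image[symmetric]) (simp add: inj_on_def inj_map_eq_map)
    also have "\<dots> \<le> card Neg"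
      by (rule card_mono[OF fin(2)]) (auto simp: Pos_def Neg_def neg last_neg)
    finally have "2 * card Pos + 1 \<le> card Pos + card Neg + card {?zero}"
      by simp
    also have "\<dots> = card (Pos \<union> Neg \<union> {?zero})"
    proof -
      have "last ?zero = 0" by (simp add: last_replicate del: replicate_Suc)
      then have "?zero \<notin> Pos \<union> Neg" by (auto simp: Pos_def Neg_def simp del: replicate_Suc)
      moreover have "Pos \<inter> Neg = {}" by (auto simp: Pos_def Neg_def)
      ultimately show ?thesis
        using fin by (simp add: card_Un_disjoint del: replicate_Suc)
    qed
    also have "\<dots> \<le> card Q"
    proof (rule card_mono[OF Q(1)])
      show "Pos \<union> Neg \<union> {?zero} \<subseteq> Q"
        using zero[OF False] unfolding Pos_def Neg_def by blast
    qed
    finally show ?thesis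
      using card by simp
  qed
  moreover have "card bad \<le> card Pos"
  proof -
    have "\<forall>z\<in>bad. \<exists>h. h \<in> Pos \<and> [dot h (zs @ [z]) = 0] (mod int n)"
      by (auto simp: bad_def)
    then obtain f where f: "\<And>z. z \<in> bad \<Longrightarrow> f z \<in> Pos \<and> [dot (f z) (zs @ [z]) = 0] (mod int n)"
      using bchoice[of bad "\<lambda>z h. h \<in> Pos \<and> [dot h (zs @ [z]) = 0] (mod int n)"] by blast
    \<comment> \<open>Choosing an excluding vector for each bad residue is injective, since a vector excludes only one.\<close>
    have "inj_on f bad"
    proof (rule inj_onI)
      fix z z' assume z: "z \<in> bad" "z' \<in> bad" and eq: "f z = f z'"
      have "f z \<in> Q" "last (f z) > 0"
        using f[OF z(1)] by (auto simp: Pos_def)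
      then obtain h x where h: "f z = h @ [x]" "length h = length zs" "x > 0"
        using snoc by force
      have "x < int n"
        using bound[OF \<open>f z \<in> Q\<close>, of x] h by simp
      moreover have "[dot h zs + x * z = 0] (mod int n)" "[dot h zs + x * z' = 0] (mod int n)"
        using f[OF z(1)] f[OF z(2)] eq h by (metis dot_snoc)+
      moreover have "z \<in> {1..int n - 1}" "z' \<in> {1..int n - 1}"
        using z unfolding bad_def by blast+
      ultimately show "z = z'"
        using cong_cancel_residue[OF n \<open>x > 0\<close>] by blast
    qed
    then show ?thesis
      using f Q(1) by (intro card_inj_on_le[of f]) (auto simp: Pos_def)
  qed
  ultimately have "card bad < card {1..int n - 1}"
    by (simp add: nat_diff_distrib)
  then have "\<not> {1..int n - 1} \<subseteq> bad"
  proof -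
    have "finite bad" by (rule finite_subset[of _ "{1..int n - 1}"]) (auto simp: bad_def)
    then show ?thesis
      using card_mono[of bad "{1..int n - 1}"] \<open>card bad < card {1..int n - 1}\<close> by linarith
  qed
  then obtain z where z: "z \<in> {1..int n - 1}" "z \<notin> bad"
    by blast
  have "nonvanishing n Q (zs @ [z])"
    unfolding nonvanishing_def
  proof (intro ballI notI)
    fix h assume "h \<in> Q - {replicate (length (zs @ [z])) 0}"
      and cong: "[dot h (zs @ [z]) = 0] (mod int n)"
    then have h: "h \<in> Q" "h \<noteq> replicate (Suc (length zs)) 0"
      by simp_all
    then obtain h' x where hx: "h = h' @ [x]" "length h' = length zs"
      using snoc by blast
    consider "x > 0" | "x < 0" | "x = 0" by linarith
    then show False
    proof cases
      case 1
      then have "h \<in> Pos" using h hx by (simp add: Pos_def)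
      with z cong show False by (auto simp: bad_def)
    next
      case 2
      then have "map uminus h \<in> Pos" using neg[OF h(1)] hx by (simp add: Pos_def)
      moreover have "[dot (map uminus h) (zs @ [z]) = 0] (mod int n)"
        using cong hx by (subst dot_uminus) (auto simp: cong_0_iff)
      ultimately show False using z by (auto simp: bad_def)
    next
      case 3
      then have "h' \<in> P" using h hx proj by simp
      moreover have "h' \<noteq> replicate (length zs) 0"
        using h hx 3 by (auto simp: replicate_append_same)
      moreover have "[dot h' zs = 0] (mod int n)"
        using cong hx 3 by (simp add: dot_snoc)
      ultimately show False using P by (auto simp: nonvanishing_def)
    qed
  qed
  with z show ?thesis by blast
qed

lemma card_zero_projection_le:
  assumes "finite A"
  shows "finite (zero_projection d A s)" "card (zero_projection d A s) \<le> card A"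
proof -
  have inj: "inj_on (\<lambda>h. h @ replicate (d - s) 0) (zero_projection d A s)"
    by (auto simp: inj_on_def)
  have sub: "(\<lambda>h. h @ replicate (d - s) 0) ` zero_projection d A s \<subseteq> A"
    by (auto simp: zero_projection_def)
  show "finite (zero_projection d A s)"
    using inj_on_finite[OF inj sub assms] .
  show "card (zero_projection d A s) \<le> card A"
    using card_inj_on_le[OF inj sub assms] .
qed

lemma card_full_projection_le:
  assumes "finite A"
  shows "finite (full_projection d A s)" "card (full_projection d A s) \<le> card A"
proof -
  have sub: "full_projection d A s \<subseteq> take s ` A"
    by (force simp: full_projection_def)
  show "finite (full_projection d A s)"
    using sub assms by (meson finite_imageI finite_subset)
  show "card (full_projection d A s) \<le> card A"
    using card_mono[OF finite_imageI[OF assms] sub] card_image_le[OF assms] by (rule order_trans)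
qed

context
  fixes A :: "int list set" and d n :: nat
  assumes n: "prime n" and A: "finite A" "\<And>h. h \<in> A \<Longrightarrow> length h = d"
    and neg: "\<And>h. h \<in> A \<Longrightarrow> map uminus h \<in> A"
    and zero: "A \<noteq> {} \<Longrightarrow> replicate d 0 \<in> A"
    and bound: "\<And>h x. h \<in> A \<Longrightarrow> x \<in> set h \<Longrightarrow> \<bar>x\<bar> < int n"
    and card: "card A + 1 < 2 * n"
begin

text \<open>
  Both kinds of projection inherit symmetry, the zero vector and the bound on the entries, and have at most
  as many elements as \<open>A\<close>, so \<open>nonvanishing_extension\<close> applies in every dimension.
\<close>

lemma cbc_constructible_zero_projection: "cbc_constructible d n (zero_projection d A)"
  unfolding cbc_constructible_def
proof (intro ballI allI impI)
  fix s zs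
  assume s: "s \<in> {1..d}"
    and zs: "length zs = s - 1 \<and> set zs \<subseteq> {1..int n - 1} \<and> nonvanishing n (zero_projection d A (s - 1)) zs"
  then have len: "Suc (length zs) = s" by auto
  show "\<exists>z\<in>{1..int n - 1}. nonvanishing n (zero_projection d A s) (zs @ [z])"
  proof (rule nonvanishing_extension[OF n, where P = "zero_projection d A (s - 1)"], unfold len)
    show "map uminus h \<in> zero_projection d A s" if "h \<in> zero_projection d A s" for h
      using that neg[of "h @ replicate (d - s) 0"] by (simp add: zero_projection_def)
    show "replicate s 0 \<in> zero_projection d A s" if "zero_projection d A s \<noteq> {}"
    proof -
      have "A \<noteq> {}" using that by (auto simp: zero_projection_def)
      then show ?thesis
        using zero s by (simp add: zero_projection_def flip: replicate_add)
    qed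
    show "h \<in> zero_projection d A (s - 1)" if "h @ [0] \<in> zero_projection d A s" for h
    proof -
      have "d - (s - 1) = Suc (d - s)" using s by auto
      with that show ?thesis by (auto simp: zero_projection_def)
    qed
    show "\<bar>x\<bar> < int n" if "h \<in> zero_projection d A s" "x \<in> set h" for h x
      using that bound by (auto simp: zero_projection_def)
  qed (use card_zero_projection_le[OF A(1), of d s] card zs in \<open>auto simp: zero_projection_def\<close>)
qed

lemma cbc_constructible_full_projection: "cbc_constructible d n (full_projection d A)"
  unfolding cbc_constructible_def
proof (intro ballI allI impI)
  fix s zs
  assume s: "s \<in> {1..d}"
    and zs: "length zs = s - 1 \<and> set zs \<subseteq> {1..int n - 1} \<and> nonvanishing n (full_projection d A (s - 1)) zs"
  then have len: "Suc (length zs) = s" by auto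
  show "\<exists>z\<in>{1..int n - 1}. nonvanishing n (full_projection d A s) (zs @ [z])"
  proof (rule nonvanishing_extension[OF n, where P = "full_projection d A (s - 1)"], unfold len)
    show "map uminus h \<in> full_projection d A s" if "h \<in> full_projection d A s" for h
    proof -
      from that obtain h' where "length h = s" "length h' = d - s" "h @ h' \<in> A"
        by (auto simp: full_projection_def)
      then show ?thesis
        using neg[of "h @ h'"] unfolding full_projection_def
        by (auto intro!: exI[of _ "map uminus h'"])
    qed
    show "replicate s 0 \<in> full_projection d A s" if "full_projection d A s \<noteq> {}"
    proof -
      have "A \<noteq> {}" using that by (auto simp: full_projection_def)
      then have "replicate s 0 @ replicate (d - s) 0 \<in> A"
        using zero s by (simp flip: replicate_add)
      then show ?thesis
        unfolding full_projection_def by (auto intro!: exI[of _ "replicate (d - s) 0"])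
    qed
    show "h \<in> full_projection d A (s - 1)" if "h @ [0] \<in> full_projection d A s" for h
    proof -
      from that obtain h' where "length h = s - 1" "length h' = d - s" "h @ 0 # h' \<in> A"
        by (auto simp: full_projection_def)
      then show ?thesis
        using s unfolding full_projection_def by (auto intro!: exI[of _ "0 # h'"])
    qed
    show "\<bar>x\<bar> < int n" if "h \<in> full_projection d A s" "x \<in> set h" for h x
      using that bound by (fastforce simp: full_projection_def)
  qed (use card_full_projection_le[OF A(1), of d s] card zs in \<open>auto simp: full_projection_def\<close>)
qed

end

lemma cbc_constructible_imp_ex:
  assumes cbc: "cbc_constructible d n P" and P0: "nonvanishing n (P 0) []"
  shows "\<exists>z. length z = d \<and> set z \<subseteq> {1..int n - 1} \<and> nonvanishing n (P d) z"
proof -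
  have "\<exists>z. length z = s \<and> set z \<subseteq> {1..int n - 1} \<and> nonvanishing n (P s) z" if "s \<le> d" for s
    using that
  proof (induction s)
    case 0
    show ?case using P0 by simp
  next
    case (Suc s)
    then obtain zs where zs: "length zs = s" "set zs \<subseteq> {1..int n - 1}" "nonvanishing n (P s) zs"
      by auto
    moreover have "Suc s \<in> {1..d}" using Suc.prems by simp
    ultimately obtain z where "z \<in> {1..int n - 1}" "nonvanishing n (P (Suc s)) (zs @ [z])"
      using cbc unfolding cbc_constructible_def by (metis diff_Suc_1)
    with zs show ?case by (intro exI[of _ "zs @ [z]"]) auto
  qed
  then show ?thesis by simp
qed

lemma zero_projection_full_dim:
  "(\<And>h. h \<in> A \<Longrightarrow> length h = d) \<Longrightarrow> zero_projection d A d = A"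
  by (auto simp: zero_projection_def)

section \<open>Exact reconstruction of Chebyshev coefficients\<close>

theorem lemma19:
  fixes d :: nat and \<Lambda> :: "nat list set"
  assumes "d \<ge> 1" and "finite \<Lambda>" and "\<forall>k\<in>\<Lambda>. length k = d"
  shows "(\<forall>(n::nat) (z::int list). n \<ge> 1 \<and> length z = d \<longrightarrow>
            ((\<forall>f \<in> cheb_space d \<Lambda>. \<forall>k\<in>\<Lambda>. cheb_coeff d f k = approx_coeff d n z f k)
             \<longleftrightarrow> (\<forall>h \<in> set_sum (mirror \<Lambda>) (mirror \<Lambda>) - {replicate d 0}.
                    \<not> [dot h z = 0] (mod int n))))
       \<and> (\<forall>n::nat. prime n \<and>
            real n > max ((real (card (set_sum (mirror \<Lambda>) (mirror \<Lambda>))) + 1) / 2)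
                         (2 * real (max_index \<Lambda>)) \<longrightarrow>
            cbc_constructible d n (zero_projection d (set_sum (mirror \<Lambda>) (mirror \<Lambda>)))
            \<and> cbc_constructible d n (full_projection d (set_sum (mirror \<Lambda>) (mirror \<Lambda>)))
            \<and> (\<exists>z. length z = d \<and> set z \<subseteq> {1..int n - 1} \<and>
                 (\<forall>h \<in> set_sum (mirror \<Lambda>) (mirror \<Lambda>) - {replicate d 0}.
                    \<not> [dot h z = 0] (mod int n))))"
proof (intro conjI allI impI)
  fix n :: nat and z :: "int list"
  assume "n \<ge> 1 \<and> length z = d"
  then show "(\<forall>f \<in> cheb_space d \<Lambda>. \<forall>k\<in>\<Lambda>. cheb_coeff d f k = approx_coeff d n z f k)
      \<longleftrightarrow> (\<forall>h \<in> set_sum (mirror \<Lambda>) (mirror \<Lambda>) - {replicate d 0}. \<not> [dot h z = 0] (mod int n))"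
    using reconstruction_iff_nonvanishing[OF assms(2,3), of n z] by (simp only: nonvanishing_def)
next
  fix n :: nat
  let ?A = "set_sum (mirror \<Lambda>) (mirror \<Lambda>)"
  assume n: "prime n \<and> real n > max ((real (card ?A) + 1) / 2) (2 * real (max_index \<Lambda>))"
  then have "prime n" by blast
  have card: "card ?A + 1 < 2 * n" and "2 * max_index \<Lambda> < n"
    using n by (simp_all add: field_simps)
  note props = set_sum_mirror_properties[OF assms(2,3)]
  have bound: "\<bar>x\<bar> < int n" if "h \<in> ?A" "x \<in> set h" for h x
    using props(5)[OF that] \<open>2 * max_index \<Lambda> < n\<close> by linarith
  show zero: "cbc_constructible d n (zero_projection d ?A)"
    by (rule cbc_constructible_zero_projection[OF \<open>prime n\<close> props(1-4) bound card])
  show "cbc_constructible d n (full_projection d ?A)"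
    by (rule cbc_constructible_full_projection[OF \<open>prime n\<close> props(1-4) bound card])
  \<comment> \<open>The zero projection is trivial in dimension \<open>0\<close> and is all of \<open>?A\<close> in dimension \<open>d\<close>.\<close>
  have "nonvanishing n (zero_projection d ?A 0) []"
    by (auto simp: nonvanishing_def zero_projection_def)
  from cbc_constructible_imp_ex[OF zero this]
  obtain z where "length z = d" "set z \<subseteq> {1..int n - 1}" "nonvanishing n (zero_projection d ?A d) z"
    by blast
  moreover have "zero_projection d ?A d = ?A"
    by (rule zero_projection_full_dim) (rule props(2))
  ultimately show "\<exists>z. length z = d \<and> set z \<subseteq> {1..int n - 1} \<and>
      (\<forall>h \<in> ?A - {replicate d 0}. \<not> [dot h z = 0] (mod int n))"
    unfolding nonvanishing_def by (intro exI[of _ z]) simp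
qed

end
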